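(* Let $r$ be an integer with $1\le r\le 10$, let $(z_i)_i$ be a finite family of integers with every $z_i\ge 4$, and let $(c_i)_i$ be arbitrary constants. For nonnegative integers $j\le 100$ put $$F=F(j)=\sum_{s\ge 0}\frac{a_s(r,j)}{n^s}+\sum_i c_i\, j(j-1)\cdots(j-z_i+1)\,\frac{1}{n^{z_i}r^{z_i}}\sum_{s\ge 0}\frac{a_s(r,j-z_i)}{n^s}.$$ Then for every integer $h$ with $1\le h\le 26$ the coefficient $[n^{-h}]\ln(F)$ is a polynomial in $j$ satisfying $$[j^k n^{-h}]\ln(F)=0\quad\text{for all } k\ge h+2,\qquad [j^{h+1}n^{-h}]\ln(F)=\frac{1}{(h+1)h}\Bigl(\frac{1}{r^h}-2\Bigr).$$ That is, there is a polynomial $q_h$ of degree at most $h+1$, whose coefficient of $j^{h+1}$ is $\frac{1}{(h+1)h}\bigl(\frac1{r^h}-2\bigr)$, such that $[n^{-h}]\ln(F(j))=q_h(j)$ for all integers $0\le j\le 100$.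
   Context: For a positive integer $r$ define the power series in $x$ $$T_r(x)=\frac{2(r-1)}{2(r-1)-r+r\sqrt{1-4x(r-1)}}$$ (its coefficients are polynomials in $r$; for $r=1$ use these polynomials at $r=1$), and let $u_s(r)=[x^s]T_r$ for $s\ge 2$, where $[x^s]f$ is the coefficient of $x^s$ in $f$. For integers $j\ge 0$ set $$M_j=[x^j]\exp\Bigl(nrx-\sum_{s\ge 2}\frac{n\,u_s(r)}{s}(-x)^s\Bigr),$$ and define $a_s(r,j)$ by $$M_j=\frac{n^jr^j}{j!}\sum_{s\ge 0}\frac{a_s(r,j)}{n^s},$$ so $a_0=1$, $a_s(r,j)=0$ for $s\ge\max(j,1)$, and for fixed $r,s$ the value $a_s(r,j)$ is a polynomial in $j$, by which $a_s(r,j)$ is defined for other arguments as well (for $j<z_i$ the terms with $a_s(r,j-z_i)$ are multiplied by $0$). $\ln(F)$ is expanded as a formal power series in $1/n$ (its constant term is $0$), with the $c_i$ treated as constants; $[n^{-h}]$ denotes the coefficient of $n^{-h}$, and $[j^kn^{-h}]$ the coefficient of $j^k$ in that coefficient regarded as a polynomial in $j$. *)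

theory Defs
  imports "HOL-Computational_Algebra.Computational_Algebra"
begin

(* fps_binomial (1/2) is the power series sqrt (1 + X). The formula is meaningful for r >= 2
   only (at r = 1 it reads 0/0). *)
definition T :: "nat \<Rightarrow> 'a::field_char_0 fps" where
  "T r = fps_const (2 * (of_nat r - 1)) /
     (fps_const (2 * (of_nat r - 1) - of_nat r) +
      fps_const (of_nat r) *
        (fps_binomial (1/2) oo (- (fps_const (4 * (of_nat r - 1)) * fps_X))))"

(* [x^s] T_r as a polynomial in r; it is determined by its values at r >= 2. *)
definition u_poly :: "nat \<Rightarrow> 'a::field_char_0 poly" where
  "u_poly s = (THE p. \<forall>r::nat. r \<ge> 2 \<longrightarrow> poly p (of_nat r) = fps_nth (T r) s)"

definition u :: "nat \<Rightarrow> nat \<Rightarrow> 'a::field_char_0" where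
  "u s r = poly (u_poly s) (of_nat r)"

definition M :: "nat \<Rightarrow> nat \<Rightarrow> nat \<Rightarrow> 'a::field_char_0" where
  "M r n j = fps_nth
     (fps_exp 1 oo
       (fps_const (of_nat n * of_nat r) * fps_X -
        Abs_fps (\<lambda>s. if s \<ge> 2 then of_nat n * u s r / of_nat s * (-1) ^ s else 0))) j"

(* The finite sum \<Sum>s. a_s(r,j) / n^s as a polynomial in 1/n; since the defining identity holds
   for all positive integers n, it determines the polynomial. *)
definition a_series_nat :: "nat \<Rightarrow> nat \<Rightarrow> 'a::field_char_0 poly" where
  "a_series_nat r j = (THE p. \<forall>n::nat. n > 0 \<longrightarrow>
     M r n j = of_nat n ^ j * of_nat r ^ j / fact j * poly p (1 / of_nat n))"

(* a_s(r,j) as a polynomial in j. *)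
definition a_poly :: "nat \<Rightarrow> nat \<Rightarrow> 'a::field_char_0 poly" where
  "a_poly s r = (THE p. \<forall>j::nat. poly p (of_nat j) = coeff (a_series_nat r j) s)"

(* a_s(r,x) for an arbitrary argument x *)
definition a :: "nat \<Rightarrow> nat \<Rightarrow> 'a \<Rightarrow> 'a::field_char_0" where
  "a s r x = poly (a_poly s r) x"

(* From here on fps_X stands for 1/n. *)
definition F :: "nat \<Rightarrow> 'i set \<Rightarrow> ('i \<Rightarrow> nat) \<Rightarrow> ('i \<Rightarrow> 'a) \<Rightarrow> nat \<Rightarrow> 'a::field_char_0 fps" where
  "F r I z c j = Abs_fps (\<lambda>s. a s r (of_nat j)) +
     (\<Sum>i\<in>I. fps_const (c i * (\<Prod>k<z i. of_nat j - of_nat k) / of_nat r ^ z i) * fps_X ^ z i *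
        Abs_fps (\<lambda>s. a s r (of_nat j - of_nat (z i))))"

(* fps_ln 1 is the power series ln (1 + X); intended for f with constant term 1. *)
definition ln_fps :: "'a::field_char_0 fps \<Rightarrow> 'a fps" where
  "ln_fps f = fps_ln 1 oo (f - 1)"

end

theory Submission
  imports Defs
begin

text \<open>
  Put \<open>X = 1/n\<close> and \<open>A(x) = \<Sum>s. a_s(r,x) X^s\<close>. Call a family of power series in \<open>X\<close> that depends on
  \<open>x\<close> filtered if the coefficient of \<open>X^h\<close> is a polynomial in \<open>x\<close> of degree at most \<open>h\<close>, and call the
  series of the coefficients of \<open>x^h X^h\<close> its symbol. Filtered families are closed under ring
  operations, shifts of \<open>x\<close>, inverses of series with constant term 1, and composition with fixed series such as the logarithm; the
  symbol commutes with all of these operations and ignores shifts.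

  The family \<open>A\<close> itself is not filtered (its coefficients have degree up to \<open>2 h\<close>), but the ratio
  \<open>\<rho>(x) = A(x + 1) / A(x)\<close> is. Indeed, the generating function of the \<open>M_j\<close> is \<open>exp P\<close> with
  \<open>x P' = n (1 - T(- x))\<close>, so the \<open>M_j\<close> satisfy a linear recurrence. In terms of \<open>A\<close> it reads
  \<open>A(x + 1) = \<Sum>t. b_t x (x - 1) \<dots> (x - t + 1) X^t A(x - t)\<close> with \<open>b_0 = 1\<close> (\<open>M_Suc\<close>,
  \<open>a_recurrence\<close>). Division by \<open>A(x)\<close> expresses the coefficients of \<open>\<rho>\<close> by those of lower order,
  which shows by induction that \<open>\<rho>\<close> is filtered and that its symbol \<open>\<sigma>\<close> solves
  \<open>\<sigma> = \<Sum>t. b_t (X / \<sigma>)^t\<close> (\<open>filtered_ratio\<close>). This is a saddle point equation. With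
  \<open>x = y + (r - 1) y^2\<close> one has \<open>T(- x) = 1 / (1 + r y)\<close>, and the equation has the rational solution
  \<open>\<sigma> = (1 - X)^2 / (1 - X / r)\<close> (\<open>walk_series_at_saddle\<close>, \<open>bethe_saddle\<close>).

  Hence \<open>ln \<rho>\<close> is filtered with symbol \<open>2 ln (1 - X) - ln (1 - X / r)\<close>, whose coefficient at \<open>X^h\<close> is
  \<open>(1 / r^h - 2) / h\<close>. Since \<open>ln A(j)\<close> is the sum of \<open>ln \<rho>(i)\<close> over \<open>i < j\<close>, its coefficient at \<open>X^h\<close>
  has degree at most \<open>h + 1\<close>, and the coefficient of \<open>j^(h + 1)\<close> is that number divided by \<open>h + 1\<close>
  (\<open>antidifference\<close>, \<open>ln_a_fps_nth\<close>). Finally \<open>F = A (1 + K)\<close>, where \<open>K\<close> is a combination of terms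
  \<open>j (j - 1) \<dots> (j - z + 1) X^z A(j - z) / A(j)\<close>. These are filtered, so \<open>ln (1 + K)\<close> only contributes
  in degrees up to \<open>h\<close>.
\<close>

section \<open>Polynomial functions with a prescribed leading coefficient\<close>

text \<open>The degree bound and the coefficient at that bound are tracked together, so that vanishing of the
coefficient is allowed and the notion is stable under sums. Functions of \<open>x\<close> are used instead of
polynomials because the power series below then have coefficients in a field, where inverses and
compositions of series are available.\<close>

definition has_top_coeff :: "nat \<Rightarrow> ('a \<Rightarrow> 'a) \<Rightarrow> 'a::field_char_0 \<Rightarrow> bool" where
  "has_top_coeff h \<phi> c \<longleftrightarrow>
     (\<exists>q. degree q \<le> h \<and> coeff q h = c \<and> (\<forall>x. \<phi> x = poly q x))"

lemma poly_eqI_sequence: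
  fixes p q :: "'a::field_char_0 poly" and f :: "nat \<Rightarrow> 'a"
  assumes inj: "inj_on f {m..}" and "\<And>n. n \<ge> m \<Longrightarrow> poly p (f n) = poly q (f n)"
  shows "p = q"
proof (rule ccontr)
  assume "p \<noteq> q"
  then have "finite {x. poly (p - q) x = 0}"
    by (intro poly_roots_finite) simp
  moreover have "f ` {m..} \<subseteq> {x. poly (p - q) x = 0}"
    using assms(2) by auto
  ultimately have "finite (f ` {m..})"
    by (rule rev_finite_subset)
  then have "finite {m..}"
    using inj by (rule finite_imageD)
  then show False
    using infinite_Ici by blast
qed

lemma poly_eqI_nat:
  fixes p q :: "'a::field_char_0 poly"
  assumes "\<And>n. n \<ge> m \<Longrightarrow> poly p (of_nat n) = poly q (of_nat n)"
  shows "p = q"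
  using assms by (intro poly_eqI_sequence[of of_nat m]) (simp_all add: inj_on_def)

lemma has_top_coeff_const: "has_top_coeff 0 (\<lambda>x. c) c"
  unfolding has_top_coeff_def by (intro exI[of _ "[:c:]"]) simp

lemma has_top_coeff_add:
  assumes "has_top_coeff h \<phi> c" "has_top_coeff h \<psi> d"
  shows "has_top_coeff h (\<lambda>x. \<phi> x + \<psi> x) (c + d)"
proof -
  from assms obtain p q where
    "degree p \<le> h" "coeff p h = c" "\<forall>x. \<phi> x = poly p x"
    "degree q \<le> h" "coeff q h = d" "\<forall>x. \<psi> x = poly q x"
    unfolding has_top_coeff_def by blast
  then show ?thesis
    unfolding has_top_coeff_def
    by (intro exI[of _ "p + q"]) (auto intro: degree_add_le)
qed

lemma has_top_coeff_mult:
  assumes "has_top_coeff h \<phi> c" "has_top_coeff k \<psi> d"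
  shows "has_top_coeff (h + k) (\<lambda>x. \<phi> x * \<psi> x) (c * d)"
proof -
  from assms obtain p q where p: "degree p \<le> h" "coeff p h = c" "\<forall>x. \<phi> x = poly p x"
    and q: "degree q \<le> k" "coeff q k = d" "\<forall>x. \<psi> x = poly q x"
    unfolding has_top_coeff_def by blast
  have deg: "degree (p * q) \<le> h + k"
    using p(1) q(1) degree_mult_le[of p q] by linarith
  have "coeff (p * q) (h + k) = c * d"
  proof (cases "degree p = h \<and> degree q = k")
    case True
    then show ?thesis
      using p q coeff_mult_degree_sum[of p q] by simp
  next
    case False
    then have less: "degree p < h \<or> degree q < k"
      using p(1) q(1) by auto
    then have "degree (p * q) < h + k"
      using p(1) q(1) degree_mult_le[of p q] by linarith
    moreover have "c * d = 0"
      using less p(2) q(2) by (auto simp: coeff_eq_0)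
    ultimately show ?thesis
      by (simp add: coeff_eq_0)
  qed
  with deg p(3) q(3) show ?thesis
    unfolding has_top_coeff_def by (intro exI[of _ "p * q"]) simp
qed

lemma has_top_coeff_zero: "has_top_coeff h (\<lambda>x. 0) 0"
  unfolding has_top_coeff_def by (intro exI[of _ 0]) simp

lemma has_top_coeff_sum:
  assumes "\<And>i. i \<in> S \<Longrightarrow> has_top_coeff h (\<phi> i) (c i)"
  shows "has_top_coeff h (\<lambda>x. \<Sum>i\<in>S. \<phi> i x) (\<Sum>i\<in>S. c i)"
  using assms
proof (induction S rule: infinite_finite_induct)
  case (insert i S)
  then show ?case
    using has_top_coeff_add[of h "\<phi> i" "c i" "\<lambda>x. \<Sum>i\<in>S. \<phi> i x"] by simp
qed (simp_all add: has_top_coeff_zero)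

lemma has_top_coeff_cmult:
  "has_top_coeff h \<phi> c \<Longrightarrow> has_top_coeff h (\<lambda>x. b * \<phi> x) (b * c)"
  using has_top_coeff_mult[OF has_top_coeff_const, of h \<phi> c b] by simp

lemma has_top_coeff_shift:
  assumes "has_top_coeff h \<phi> c"
  shows "has_top_coeff h (\<lambda>x. \<phi> (x - b)) c"
proof -
  from assms obtain p where p: "degree p \<le> h" "coeff p h = c" "\<forall>x. \<phi> x = poly p x"
    unfolding has_top_coeff_def by blast
  let ?q = "pcompose p [:-b, 1:]"
  have deg: "degree ?q = degree p"
    by (simp add: degree_pcompose)
  have "coeff ?q h = c"
  proof (cases "degree p = h")
    case True
    then show ?thesis
      using deg p(2) lead_coeff_comp[of "[:-b, 1:]" p] by simp
  next
    case False
    with p(1) have "degree p < h"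
      by simp
    with deg p(2) show ?thesis
      by (auto simp: coeff_eq_0)
  qed
  with deg p show ?thesis
    unfolding has_top_coeff_def by (intro exI[of _ ?q]) (simp add: poly_pcompose)
qed

lemma has_top_coeff_falling:
  "has_top_coeff m (\<lambda>x. \<Prod>k<m. x - of_nat k) 1"
proof (induction m)
  case 0
  show ?case
    using has_top_coeff_const[of 1] by simp
next
  case (Suc m)
  have "has_top_coeff 1 (\<lambda>x. x - of_nat m) 1"
    unfolding has_top_coeff_def by (intro exI[of _ "[:- of_nat m, 1:]"]) simp
  from has_top_coeff_mult[OF Suc this] show ?case
    by simp
qed

text \<open>Falling factorials make this a one-step induction on the degree: the difference of
  \<open>x (x - 1) \<dots> (x - h)\<close> is \<open>h + 1\<close> times the falling factorial of length \<open>h\<close>.\<close>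

lemma antidifference:
  assumes "has_top_coeff h \<phi> c"
  obtains \<psi> where "has_top_coeff (Suc h) \<psi> (c / of_nat (Suc h))" "\<psi> 0 = e"
    "\<And>x. \<psi> (x + 1) - \<psi> x = \<phi> x"
proof -
  define ff :: "nat \<Rightarrow> 'a \<Rightarrow> 'a" where "ff m x = (\<Prod>k<m. x - of_nat k)" for m x
  have ff_top: "has_top_coeff m (ff m) 1" for m
    unfolding ff_def by (rule has_top_coeff_falling)
  have ff0: "ff (Suc m) 0 = 0" for m
    unfolding ff_def by (rule prod_zero) (auto intro!: bexI[of _ 0])
  have ff_diff: "ff (Suc m) (x + 1) - ff (Suc m) x = of_nat (Suc m) * ff m x" for m x
  proof -
    have "ff (Suc m) (x + 1) = (x + 1) * ff m x"
      unfolding ff_def by (subst prod.lessThan_Suc_shift) simp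
    moreover have "ff (Suc m) x = ff m x * (x - of_nat m)"
      unfolding ff_def by simp
    ultimately show ?thesis
      by (simp add: algebra_simps)
  qed
  have "\<exists>\<psi>. has_top_coeff (Suc h) \<psi> (c / of_nat (Suc h)) \<and> \<psi> 0 = e \<and>
           (\<forall>x. \<psi> (x + 1) - \<psi> x = \<phi> x)"
    using assms
  proof (induction h arbitrary: \<phi> c)
    case 0
    then obtain p where "degree p \<le> 0" "coeff p 0 = c" "\<forall>x. \<phi> x = poly p x"
      unfolding has_top_coeff_def by blast
    then have const: "\<phi> x = c" for x
      by (metis degree_eq_zeroE le_zero_eq coeff_pCons_0 poly_const_conv)
    show ?case
      by (intro exI[of _ "\<lambda>x. c * x + e"])
        (auto simp: has_top_coeff_def const algebra_simps intro!: exI[of _ "[:e, c:]"])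
  next
    case (Suc h)
    define \<phi>' where "\<phi>' x = \<phi> x - c * ff (Suc h) x" for x
    have "has_top_coeff (Suc h) \<phi>' (c + (- c) * 1)"
      unfolding \<phi>'_def diff_conv_add_uminus minus_mult_left
      by (intro has_top_coeff_add Suc.prems has_top_coeff_cmult ff_top)
    then obtain p where p: "degree p \<le> Suc h" "coeff p (Suc h) = 0" "\<forall>x. \<phi>' x = poly p x"
      unfolding has_top_coeff_def by auto
    have "degree p \<le> h"
      using p(1,2) by (metis le_SucE leading_coeff_0_iff degree_0 le0)
    with p(3) have "has_top_coeff h \<phi>' (coeff p h)"
      unfolding has_top_coeff_def by blast
    from Suc.IH[OF this] obtain \<psi> where
      \<psi>: "has_top_coeff (Suc h) \<psi> (coeff p h / of_nat (Suc h))" "\<psi> 0 = e"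
         "\<forall>x. \<psi> (x + 1) - \<psi> x = \<phi>' x"
      by blast
    let ?d = "c / of_nat (Suc (Suc h))"
    have "has_top_coeff (Suc (Suc h)) \<psi> 0"
      using \<psi>(1) unfolding has_top_coeff_def
      by (metis coeff_eq_0 le_imp_less_Suc le_SucI)
    then have "has_top_coeff (Suc (Suc h)) (\<lambda>x. \<psi> x + ?d * ff (Suc (Suc h)) x) (0 + ?d * 1)"
      by (intro has_top_coeff_add has_top_coeff_cmult ff_top)
    moreover have "(\<psi> (x + 1) + ?d * ff (Suc (Suc h)) (x + 1)) -
        (\<psi> x + ?d * ff (Suc (Suc h)) x) = \<phi> x" for x
    proof -
      have "(\<psi> (x + 1) + ?d * ff (Suc (Suc h)) (x + 1)) - (\<psi> x + ?d * ff (Suc (Suc h)) x)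
          = (\<psi> (x + 1) - \<psi> x) + ?d * (ff (Suc (Suc h)) (x + 1) - ff (Suc (Suc h)) x)"
        by (simp only: algebra_simps)
      also have "\<dots> = \<phi>' x + c * ff (Suc h) x"
        unfolding ff_diff using \<psi>(3) by (simp del: of_nat_Suc)
      finally show ?thesis
        by (simp add: \<phi>'_def)
    qed
    ultimately show ?case
      using \<psi>(2) ff0 by (intro exI[of _ "\<lambda>x. \<psi> x + ?d * ff (Suc (Suc h)) x"]) simp
  qed
  with that show ?thesis
    by blast
qed

section \<open>Filtered families of power series\<close>

text \<open>With \<open>X = 1/n\<close>, the series \<open>g\<close> is the symbol of the family: the termwise limit of \<open>f (p * n)\<close> for
\<open>n\<close> to infinity with \<open>p\<close> fixed, as a power series in \<open>p\<close>. Families of this kind form a ring on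
which the symbol is multiplicative. The cut-off \<open>N\<close> makes it possible to establish the property one
order in \<open>1/n\<close> at a time.\<close>

definition filtered :: "nat \<Rightarrow> ('a \<Rightarrow> 'a fps) \<Rightarrow> 'a::field_char_0 fps \<Rightarrow> bool" where
  "filtered N f g \<longleftrightarrow> (\<forall>h<N. has_top_coeff h (\<lambda>x. fps_nth (f x) h) (fps_nth g h))"

lemma filtered_mono: "filtered N f g \<Longrightarrow> K \<le> N \<Longrightarrow> filtered K f g"
  unfolding filtered_def by auto

lemma filtered_const: "filtered N (\<lambda>x. fps_const c) (fps_const c)"
  unfolding filtered_def
proof (intro allI impI)
  fix h assume "h < N"
  show "has_top_coeff h (\<lambda>x. fps_nth (fps_const c) h) (fps_nth (fps_const c) h)"
    by (cases h) (simp_all add: has_top_coeff_const has_top_coeff_zero)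
qed

lemma filtered_add:
  "filtered N f g \<Longrightarrow> filtered N f' g' \<Longrightarrow> filtered N (\<lambda>x. f x + f' x) (g + g')"
  unfolding filtered_def by (simp add: has_top_coeff_add)

lemma filtered_sum:
  "(\<And>i. i \<in> S \<Longrightarrow> filtered N (f i) (g i)) \<Longrightarrow> filtered N (\<lambda>x. \<Sum>i\<in>S. f i x) (\<Sum>i\<in>S. g i)"
  unfolding filtered_def by (simp add: fps_sum_nth has_top_coeff_sum)

lemma filtered_mult:
  assumes "filtered N f g" "filtered N f' g'"
  shows "filtered N (\<lambda>x. f x * f' x) (g * g')"
  unfolding filtered_def
proof (intro allI impI)
  fix h assume h: "h < N"
  have "has_top_coeff h (\<lambda>x. fps_nth (f x) i * fps_nth (f' x) (h - i))
          (fps_nth g i * fps_nth g' (h - i))" if "i \<in> {0..h}" for i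
    using has_top_coeff_mult[of i "\<lambda>x. fps_nth (f x) i" "fps_nth g i" "h - i"
        "\<lambda>x. fps_nth (f' x) (h - i)" "fps_nth g' (h - i)"] assms that h
    unfolding filtered_def by simp
  then show "has_top_coeff h (\<lambda>x. fps_nth (f x * f' x) h) (fps_nth (g * g') h)"
    unfolding fps_mult_nth by (rule has_top_coeff_sum)
qed

lemma filtered_power: "filtered N f g \<Longrightarrow> filtered N (\<lambda>x. f x ^ m) (g ^ m)"
proof (induction m)
  case 0
  then show ?case
    using filtered_const[of N 1] by simp
next
  case (Suc m)
  then show ?case
    using filtered_mult[of N f g "\<lambda>x. f x ^ m"] by simp
qed

lemma filtered_shift: "filtered N f g \<Longrightarrow> filtered N (\<lambda>x. f (x - b)) g"
  unfolding filtered_def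
proof (intro allI impI)
  fix h assume "\<forall>h<N. has_top_coeff h (\<lambda>x. fps_nth (f x) h) (fps_nth g h)" "h < N"
  then show "has_top_coeff h (\<lambda>x. fps_nth (f (x - b)) h) (fps_nth g h)"
    using has_top_coeff_shift[of h "\<lambda>x. fps_nth (f x) h"] by blast
qed

lemma filtered_compose:
  assumes "filtered N f g"
  shows "filtered N (\<lambda>x. H oo f x) (H oo g)"
  unfolding filtered_def fps_compose_nth
proof (intro allI impI has_top_coeff_sum has_top_coeff_cmult)
  fix h i assume "h < N"
  then show "has_top_coeff h (\<lambda>x. fps_nth (f x ^ i) h) (fps_nth (g ^ i) h)"
    using filtered_power[OF assms] unfolding filtered_def by blast
qed

lemma fps_minus_one: "p - 1 = p + fps_const (- 1)" for p :: "'a::comm_ring_1 fps"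
  by (simp add: fps_eq_iff)

text \<open>Inversion thereby becomes a case of composition with a fixed series.\<close>

lemma fps_inverse_eq_compose:
  fixes f :: "'a::field_char_0 fps"
  assumes "fps_nth f 0 = 1"
  shows "inverse f = inverse (1 + fps_X) oo (f - 1)"
  using assms by (simp add: fps_inverse_compose fps_compose_add_distrib)

lemma filtered_inverse:
  assumes "filtered N f g" "\<And>x. fps_nth (f x) 0 = 1" "fps_nth g 0 = 1"
  shows "filtered N (\<lambda>x. inverse (f x)) (inverse g)"
proof -
  have "filtered N (\<lambda>x. f x - 1) (g - 1)"
    unfolding fps_minus_one by (intro filtered_add assms(1) filtered_const)
  from filtered_compose[OF this, of "inverse (1 + fps_X)"] show ?thesis
    by (simp only: fps_inverse_eq_compose[OF assms(2)] fps_inverse_eq_compose[OF assms(3)])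
qed

text \<open>A factor \<open>X ^ m\<close> pays for \<open>m\<close> further degrees in \<open>x\<close> and at the same time moves the cut-off by
\<open>m\<close>. The latter is what drives the induction for solutions of recurrences.\<close>

lemma filtered_X_power_mult:
  assumes "has_top_coeff m \<phi> c" "filtered N f g"
  shows "filtered (N + m) (\<lambda>x. fps_const (\<phi> x) * fps_X ^ m * f x) (fps_const c * fps_X ^ m * g)"
  unfolding filtered_def
proof (intro allI impI)
  fix h assume h: "h < N + m"
  show "has_top_coeff h (\<lambda>x. fps_nth (fps_const (\<phi> x) * fps_X ^ m * f x) h)
      (fps_nth (fps_const c * fps_X ^ m * g) h)"
  proof (cases "h < m")
    case True
    then show ?thesis
      by (simp add: mult.assoc fps_X_power_mult_nth has_top_coeff_zero)
  next
    case False
    have "has_top_coeff (h - m) (\<lambda>x. fps_nth (f x) (h - m)) (fps_nth g (h - m))"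
      using assms(2) False h unfolding filtered_def by simp
    from has_top_coeff_mult[OF assms(1) this] False show ?thesis
      by (simp add: mult.assoc fps_X_power_mult_nth)
  qed
qed

lemma filtered_cong:
  assumes "filtered N f g"
    and "\<And>h x. h < N \<Longrightarrow> fps_nth (f x) h = fps_nth (f' x) h"
    and "\<And>h. h < N \<Longrightarrow> fps_nth g h = fps_nth g' h"
  shows "filtered N f' g'"
  using assms unfolding filtered_def by simp

text \<open>Telescoping: \<open>A (x - t) / A x\<close> is a product of \<open>t\<close> inverse ratios of neighbours, and a shift of the
argument does not change a symbol.\<close>

lemma filtered_backshift:
  fixes A :: "'a::field_char_0 \<Rightarrow> 'a fps"
  assumes A0: "\<And>x. fps_nth (A x) 0 = 1"
    and ratio: "filtered N (\<lambda>x. A (x + 1) * inverse (A x)) \<sigma>" and \<sigma>0: "fps_nth \<sigma> 0 = 1"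
  shows "filtered N (\<lambda>x. A (x - of_nat t) * inverse (A x)) (inverse \<sigma> ^ t)"
proof (induction t)
  case 0
  have A_inv: "A x * inverse (A x) = 1" for x
    using A0 by (intro inverse_mult_eq_1') simp
  show ?case
    using filtered_const[of N 1] by (simp add: A_inv)
next
  case (Suc t)
  have A_inv: "A x * inverse (A x) = 1" for x
    using A0 by (intro inverse_mult_eq_1') simp
  have "filtered N (\<lambda>x. inverse (A (x + 1) * inverse (A x))) (inverse \<sigma>)"
    using ratio A0 \<sigma>0 by (intro filtered_inverse) simp_all
  from filtered_mult[OF Suc filtered_shift[OF this, of "of_nat (Suc t)"]]
  have "filtered N (\<lambda>x. A (x - of_nat t) * inverse (A x) *
      inverse (A (x - of_nat (Suc t) + 1) * inverse (A (x - of_nat (Suc t)))))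
      (inverse \<sigma> ^ t * inverse \<sigma>)" .
  moreover have "A (x - of_nat t) * inverse (A x) *
      inverse (A (x - of_nat (Suc t) + 1) * inverse (A (x - of_nat (Suc t))))
      = A (x - of_nat (Suc t)) * inverse (A x)" for x
  proof -
    have "x - of_nat (Suc t) + 1 = x - of_nat t"
      by simp
    moreover have "inverse (inverse (A y)) = A y" for y
      using A0[of y] by (intro fps_inverse_idempotent) simp
    moreover have "p * q * (p' * s) = s * q" if "p * p' = 1" for p p' q s :: "'a fps"
      using that by algebra
    ultimately show ?thesis
      using A_inv[of "x - of_nat t"] by (simp only: fps_inverse_mult)
  qed
  ultimately show ?case
    by (simp only: power_Suc2)
qed

text \<open>Dividing the recurrence by \<open>A x\<close> gives \<open>A (x + 1) / A x\<close> as a sum of terms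
\<open>b_t * x (x - 1) \<dots> (x - t + 1) * X ^ t * A (x - t) / A x\<close>. The last quotient is determined by the
ratios of neighbours, and the factor \<open>X ^ t\<close> with \<open>t \<ge> 1\<close> makes its coefficients of lower order
suffice. So the ratio is a fixed point of a contraction that preserves filtered families, and the
equation for \<open>\<sigma>\<close> is the same fixed point equation for the symbols.\<close>

lemma filtered_ratio:
  fixes A :: "'a::field_char_0 \<Rightarrow> 'a fps" and b \<sigma> :: "'a fps"
  assumes A0: "\<And>x. fps_nth (A x) 0 = 1"
    and rec: "\<And>x h. fps_nth (A (x + 1)) h =
      (\<Sum>t\<le>h. fps_nth b t * (\<Prod>k<t. x - of_nat k) * fps_nth (A (x - of_nat t)) (h - t))"
    and \<sigma>0: "fps_nth \<sigma> 0 = 1"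
    and \<sigma>: "\<sigma> = b oo (fps_X * inverse \<sigma>)"
  shows "filtered N (\<lambda>x. A (x + 1) * inverse (A x)) \<sigma>"
proof (induction N)
  case 0
  show ?case
    by (simp add: filtered_def)
next
  case (Suc N)
  define ff :: "nat \<Rightarrow> 'a \<Rightarrow> 'a" where "ff t x = (\<Prod>k<t. x - of_nat k)" for t x
  define B where "B t x = A (x - of_nat t) * inverse (A x)" for t x
  define R where "R x = (\<Sum>t\<le>N. fps_const (fps_nth b t * ff t x) * fps_X ^ t * B t x)" for x
  define G where "G = (\<Sum>t\<le>N. fps_const (fps_nth b t * 1) * fps_X ^ t * inverse \<sigma> ^ t)"
  have "filtered (Suc N) R G"
    unfolding R_def[abs_def] G_def
  proof (rule filtered_sum)
    fix t assume t: "t \<in> {..N}"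
    have "filtered (Suc N - t) (B t) (inverse \<sigma> ^ t)"
    proof (cases t)
      case 0
      have "A x * inverse (A x) = 1" for x
        using A0 by (intro inverse_mult_eq_1') simp
      with 0 show ?thesis
        using filtered_const[of "Suc N" 1] by (simp add: B_def[abs_def])
    next
      case (Suc t')
      then show ?thesis
        using filtered_mono[OF filtered_backshift[OF A0 Suc.IH \<sigma>0, of t]]
        by (simp add: B_def[abs_def])
    qed
    from filtered_X_power_mult[OF has_top_coeff_cmult[OF has_top_coeff_falling] this]
    have "filtered (Suc N - t + t) (\<lambda>x. fps_const (fps_nth b t * ff t x) * fps_X ^ t * B t x)
        (fps_const (fps_nth b t * 1) * fps_X ^ t * inverse \<sigma> ^ t)"
      unfolding ff_def by blast
    then show "filtered (Suc N) (\<lambda>x. fps_const (fps_nth b t * ff t x) * fps_X ^ t * B t x)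
        (fps_const (fps_nth b t * 1) * fps_X ^ t * inverse \<sigma> ^ t)"
      by (rule filtered_mono) (use t in simp)
  qed
  then show ?case
  proof (rule filtered_cong)
    fix h x assume h: "h < Suc N"
    define S where "S = (\<Sum>t\<le>N. fps_const (fps_nth b t * ff t x) * fps_X ^ t * A (x - of_nat t))"
    have S: "fps_nth (A (x + 1)) i = fps_nth S i" if "i \<le> h" for i
    proof -
      have "fps_nth S i = (\<Sum>t\<le>N. fps_nth b t * ff t x *
          (if i < t then 0 else fps_nth (A (x - of_nat t)) (i - t)))"
        unfolding S_def by (simp add: fps_sum_nth mult.assoc fps_X_power_mult_nth)
      also have "\<dots> = (\<Sum>t\<le>i. fps_nth b t * ff t x *
          (if i < t then 0 else fps_nth (A (x - of_nat t)) (i - t)))"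
        using h that by (intro sum.mono_neutral_right) auto
      also have "\<dots> = fps_nth (A (x + 1)) i"
        unfolding rec ff_def by (intro sum.cong) auto
      finally show ?thesis ..
    qed
    have "fps_nth (A (x + 1) * inverse (A x)) h = fps_nth (S * inverse (A x)) h"
      unfolding fps_mult_nth by (intro sum.cong) (auto simp: S)
    also have "S * inverse (A x) = R x"
      unfolding S_def R_def B_def sum_distrib_right by (simp only: mult.assoc)
    finally show "fps_nth (R x) h = fps_nth (A (x + 1) * inverse (A x)) h" ..
  next
    fix h assume h: "h < Suc N"
    have "fps_nth \<sigma> h = (\<Sum>t\<in>{0..h}. fps_nth b t * fps_nth ((fps_X * inverse \<sigma>) ^ t) h)"
      by (subst \<sigma>) (rule fps_compose_nth)
    also have "\<dots> = (\<Sum>t\<le>N. fps_nth b t * fps_nth ((fps_X * inverse \<sigma>) ^ t) h)"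
      using h by (intro sum.mono_neutral_left)
        (auto simp: power_mult_distrib fps_X_power_mult_nth)
    also have "\<dots> = fps_nth G h"
      unfolding G_def by (simp add: fps_sum_nth power_mult_distrib mult.assoc)
    finally show "fps_nth G h = fps_nth \<sigma> h" ..
  qed
qed

section \<open>The logarithm of a power series\<close>

lemma ln_fps_nth_0 [simp]: "fps_nth (ln_fps f) 0 = 0"
  by (simp add: ln_fps_def)

lemma fps_deriv_ln_fps:
  fixes f :: "'a::field_char_0 fps"
  assumes "fps_nth f 0 = 1"
  shows "fps_deriv (ln_fps f) = inverse f * fps_deriv f"
  using assms
  by (simp add: ln_fps_def fps_compose_deriv fps_ln_deriv fps_inverse_eq_compose[OF assms])

lemma ln_fps_mult:
  fixes f g :: "'a::field_char_0 fps"
  assumes "fps_nth f 0 = 1" "fps_nth g 0 = 1"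
  shows "ln_fps (f * g) = ln_fps f + ln_fps g"
proof -
  have "f * inverse f = 1" "g * inverse g = 1"
    using assms by (auto intro!: inverse_mult_eq_1')
  then have "inverse (f * g) * fps_deriv (f * g) = inverse f * fps_deriv f + inverse g * fps_deriv g"
    unfolding fps_inverse_mult fps_deriv_mult by algebra
  then have "fps_deriv (ln_fps (f * g)) = fps_deriv (ln_fps f + ln_fps g)"
    using assms by (simp add: fps_deriv_ln_fps)
  then show ?thesis
    unfolding fps_deriv_eq_iff by simp
qed

lemma ln_fps_one_minus_linear_nth:
  "fps_nth (ln_fps (1 - fps_const c * fps_X)) h = - (c ^ h / of_nat h)"
proof -
  have "1 - fps_const c * fps_X - 1 = fps_const (- c) * fps_X"
    by (simp add: fps_eq_iff)
  then have "fps_nth (ln_fps (1 - fps_const c * fps_X)) h = (- c) ^ h * fps_nth (fps_ln 1) h"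
    unfolding ln_fps_def by (simp only: fps_nth_compose_linear)
  then show ?thesis
    by (cases h) (simp_all add: fps_ln_nth power_minus[of c] minus_one_power_iff)
qed

lemma filtered_ln_fps:
  assumes "filtered N f g"
  shows "filtered N (\<lambda>x. ln_fps (f x)) (ln_fps g)"
proof -
  show ?thesis
    unfolding ln_fps_def fps_minus_one
    by (intro filtered_compose filtered_add assms filtered_const)
qed

text \<open>The exponential of the derivative with respect to \<open>p\<close> of
\<open>(t - p) ln (1 - p / t) - 2 (1 - p) ln (1 - p) - p\<close>. For \<open>t = r\<close>, adding
\<open>p ln r - p ln p + p\<close>, the contribution of the factor \<open>(n r) ^ j / j!\<close> with \<open>j = p n\<close>, turns
this function into the Bethe entropy (per vertex of one class) of matchings of density \<open>p\<close> in
\<open>r\<close>-regular bipartite graphs.\<close>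

definition bethe :: "'a::field_char_0 \<Rightarrow> 'a fps" where
  "bethe t = (1 - fps_X)\<^sup>2 * inverse (1 - fps_const (1 / t) * fps_X)"

lemma bethe_nth_0 [simp]: "fps_nth (bethe t) 0 = 1"
  by (simp add: bethe_def power2_eq_square)

lemma ln_bethe_nth:
  fixes t :: "'a::field_char_0"
  shows "fps_nth (ln_fps (bethe t)) h = (1 / t ^ h - 2) / of_nat h"
proof -
  let ?d = "1 - fps_const (1 / t) * fps_X"
  have inv: "?d * inverse ?d = 1"
    by (rule inverse_mult_eq_1') simp
  have "bethe t * ?d = (1 - fps_X) * (1 - fps_X)"
    using inv unfolding bethe_def by algebra
  then have "ln_fps (bethe t) + ln_fps ?d = ln_fps (1 - fps_X) + ln_fps (1 - fps_X)"
    by (simp flip: ln_fps_mult)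
  then have "fps_nth (ln_fps (bethe t)) h + fps_nth (ln_fps ?d) h =
      fps_nth (ln_fps (1 - fps_X)) h + fps_nth (ln_fps (1 - fps_X)) h"
    by (metis fps_add_nth)
  moreover have "fps_nth (ln_fps (1 - fps_X)) h = - (1 / of_nat h :: 'a)"
    using ln_fps_one_minus_linear_nth[of 1 h] by simp
  ultimately have "fps_nth (ln_fps (bethe t)) h = (1 / t) ^ h / of_nat h - 2 / of_nat h"
    unfolding ln_fps_one_minus_linear_nth by (simp add: algebra_simps)
  then show ?thesis
    by (simp add: power_one_over diff_divide_distrib)
qed

section \<open>The walk series as an algebraic function\<close>

text \<open>\<open>(sqrt (1 + 4 X) - 1) / (2 X)\<close>, the generating function of the Catalan numbers with alternating signs.\<close>

definition sqrt_quot :: "'a::field_char_0 fps" where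
  "sqrt_quot = Abs_fps (\<lambda>h. ((1 / 2) gchoose Suc h) * 4 ^ Suc h / 2)"

lemma sqrt_quot_eq: "sqrt_quot + fps_X * sqrt_quot\<^sup>2 = (1 :: 'a::field_char_0 fps)"
proof -
  let ?E = "sqrt_quot :: 'a fps"
  let ?Q = "fps_binomial (1 / 2) oo (fps_const 4 * fps_X) :: 'a fps"
  have Q: "?Q = 1 + 2 * fps_X * ?E"
  proof (rule fps_ext)
    fix h show "fps_nth ?Q h = fps_nth (1 + 2 * fps_X * ?E) h"
      by (cases h) (simp_all add: sqrt_quot_def mult.assoc numeral_fps_const)
  qed
  have "?Q * ?Q = (fps_binomial (1 / 2) * fps_binomial (1 / 2)) oo (fps_const 4 * fps_X)"
    by (simp add: fps_compose_mult_distrib)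
  also have "fps_binomial (1 / 2) * fps_binomial (1 / 2) = (1 + fps_X :: 'a fps)"
    by (simp flip: fps_binomial_add_mult add: fps_binomial_1)
  also have "(1 + fps_X) oo (fps_const 4 * fps_X) = 1 + 4 * (fps_X :: 'a fps)"
    by (simp add: fps_compose_add_distrib numeral_fps_const)
  finally have "4 * fps_X * (?E + fps_X * ?E\<^sup>2) = 4 * fps_X * 1"
    unfolding Q by (simp add: algebra_simps power2_eq_square)
  moreover have "4 * fps_X \<noteq> (0 :: 'a fps)"
    by simp
  ultimately show ?thesis
    using mult_left_cancel by blast
qed

text \<open>The compositional inverse of \<open>y + (t - 1) y ^ 2\<close>. Written this way, it also makes sense for
\<open>t = 1\<close>, and its coefficients are visibly polynomials in \<open>t\<close>.\<close>

definition walk_root :: "'a::field_char_0 \<Rightarrow> 'a fps" where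
  "walk_root t = fps_X * (sqrt_quot oo (fps_const (t - 1) * fps_X))"

lemma walk_root_nth_0 [simp]: "fps_nth (walk_root t) 0 = 0"
  by (simp add: walk_root_def)

lemma walk_root_nth_Suc: "fps_nth (walk_root t) (Suc h) = (t - 1) ^ h * fps_nth sqrt_quot h"
  by (simp add: walk_root_def)

lemma walk_root_eq: "walk_root t + fps_const (t - 1) * (walk_root t)\<^sup>2 = fps_X"
proof -
  let ?L = "fps_const (t - 1) * fps_X"
  have "(sqrt_quot + fps_X * sqrt_quot\<^sup>2) oo ?L = 1"
    by (simp add: sqrt_quot_eq)
  then have "(sqrt_quot oo ?L) + ?L * (sqrt_quot oo ?L)\<^sup>2 = 1"
    by (simp add: fps_compose_add_distrib fps_compose_mult_distrib fps_compose_power)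
  then have "fps_X * ((sqrt_quot oo ?L) + ?L * (sqrt_quot oo ?L)\<^sup>2) = fps_X"
    by simp
  then show ?thesis
    by (simp add: walk_root_def algebra_simps power2_eq_square)
qed

text \<open>The series \<open>T\<close> at \<open>- X\<close>, without the singularity of its closed form at \<open>r = 1\<close>. Up to sign,
the coefficient at \<open>s\<close> counts the closed walks of length \<open>2 s\<close> from a vertex of the
\<open>t\<close>-regular tree, for integers \<open>t \<ge> 1\<close>.\<close>

definition walk_series :: "'a::field_char_0 \<Rightarrow> 'a fps" where
  "walk_series t = inverse (1 + fps_const t * walk_root t)"

text \<open>The square root in \<open>T\<close> equals \<open>1 + 2 (r - 1) y\<close> with \<open>y\<close> the root at \<open>- X\<close>, so that the
denominator is \<open>2 (r - 1) (1 + r y)\<close> and the factor \<open>2 (r - 1)\<close> cancels.\<close>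

lemma T_eq_walk_series:
  assumes "r \<ge> 2"
  shows "T r = walk_series (of_nat r) oo (fps_const (- 1) * fps_X :: 'a::field_char_0 fps)"
proof -
  let ?p = "of_nat r - 1 :: 'a"
  let ?W = "walk_root (of_nat r) oo (fps_const (- 1) * fps_X) :: 'a fps"
  have p: "?p \<noteq> 0"
    using assms by simp
  have root: "fps_binomial (1 / 2) oo (- (fps_const (4 * ?p) * fps_X)) = 1 + fps_const (2 * ?p) * ?W"
    (is "?Q = _")
  proof (rule fps_ext)
    fix h
    have "- (fps_const (4 * ?p) * fps_X) = fps_const (- 4 * ?p) * fps_X"
      by (simp add: fps_eq_iff)
    then have "fps_nth ?Q h = (- 4 * ?p) ^ h * ((1 / 2) gchoose h)"
      by (metis fps_nth_compose_linear fps_binomial_nth)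
    also have "(- 4 * ?p) ^ h = (- 1) ^ h * 4 ^ h * ?p ^ h"
      by (simp flip: power_mult_distrib)
    also have "\<dots> * ((1 / 2) gchoose h) = fps_nth (1 + fps_const (2 * ?p) * ?W) h"
      unfolding fps_add_nth fps_mult_left_const_nth fps_nth_compose_linear
      by (cases h) (simp_all add: walk_root_nth_Suc sqrt_quot_def mult_ac)
    finally show "fps_nth ?Q h = fps_nth (1 + fps_const (2 * ?p) * ?W) h" .
  qed
  let ?D = "1 + fps_const (of_nat r) * ?W"
  have "fps_const (2 * ?p - of_nat r) + fps_const (of_nat r) * (1 + fps_const (2 * ?p) * ?W)
      = fps_const (2 * ?p) * ?D"
    by (simp add: algebra_simps fps_const_mult[symmetric] fps_const_sub[symmetric]
        del: fps_const_mult fps_const_sub)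
  then have "T r = fps_const (2 * ?p) / (fps_const (2 * ?p) * ?D)"
    by (simp only: T_def root)
  also have "\<dots> = fps_const (2 * ?p) * (inverse (fps_const (2 * ?p)) * inverse ?D)"
    using p by (subst fps_divide_unit) (simp_all add: fps_inverse_mult)
  also have "\<dots> = inverse ?D"
    using p by (simp add: fps_const_inverse flip: mult.assoc)
  also have "\<dots> = walk_series (of_nat r) oo (fps_const (- 1) * fps_X)"
    by (simp add: walk_series_def fps_inverse_compose fps_compose_add_distrib
        fps_compose_mult_distrib)
  finally show ?thesis .
qed

text \<open>Polynomiality in \<open>t\<close> is again an instance of filtered families, now with \<open>t\<close> in the role of \<open>x\<close>.
It extends the identity for \<open>T r\<close> from \<open>r \<ge> 2\<close> to \<open>r = 1\<close>.\<close>

lemma u_eq: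
  assumes "r \<ge> 1"
  shows "u s r = (- 1) ^ s * fps_nth (walk_series (of_nat r)) s"
proof -
  have "filtered (Suc s) (\<lambda>t. sqrt_quot oo (fps_const (t - 1) * fps_X :: 'a fps))
      (sqrt_quot oo (fps_X :: 'a fps))"
    unfolding filtered_def fps_nth_compose_linear fps_compose_fps_X
  proof (intro allI impI)
    fix h
    have "has_top_coeff 1 (\<lambda>t :: 'a. t - 1) 1"
      unfolding has_top_coeff_def by (intro exI[of _ "[:- 1, 1:]"]) simp
    then have "has_top_coeff h (\<lambda>t :: 'a. (t - 1) ^ h) 1"
    proof (induction h)
      case (Suc h)
      from has_top_coeff_mult[OF Suc.prems Suc.IH[OF Suc.prems]] show ?case
        by simp
    qed (simp add: has_top_coeff_const)
    from has_top_coeff_cmult[OF this, of "fps_nth sqrt_quot h"]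
    show "has_top_coeff h (\<lambda>t :: 'a. (t - 1) ^ h * fps_nth sqrt_quot h) (fps_nth sqrt_quot h)"
      by (simp add: mult.commute)
  qed
  moreover have "has_top_coeff 1 (\<lambda>t :: 'a. t) 1"
    unfolding has_top_coeff_def by (intro exI[of _ "[:0, 1:]"]) simp
  ultimately obtain g where
    "filtered (Suc s + 1) (\<lambda>t :: 'a. fps_const t * fps_X ^ 1 *
       (sqrt_quot oo (fps_const (t - 1) * fps_X))) (fps_const 1 * fps_X ^ 1 * g)"
    using filtered_X_power_mult by blast
  then have "filtered (Suc s + 1) (\<lambda>t :: 'a. fps_const t * walk_root t) (fps_X * g)"
    by (simp add: walk_root_def mult.assoc)
  from filtered_add[OF filtered_const[of _ 1] this]
  have "filtered (Suc s + 1) (\<lambda>t :: 'a. 1 + fps_const t * walk_root t) (1 + fps_X * g)"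
    by simp
  then have "filtered (Suc s + 1) (walk_series :: 'a \<Rightarrow> 'a fps) (inverse (1 + fps_X * g))"
    unfolding walk_series_def[abs_def] by (rule filtered_inverse) simp_all
  then have "has_top_coeff s (\<lambda>t :: 'a. fps_nth (walk_series t) s)
      (fps_nth (inverse (1 + fps_X * g)) s)"
    unfolding filtered_def by simp
  then obtain p :: "'a poly" where p: "\<And>t. fps_nth (walk_series t) s = poly p t"
    unfolding has_top_coeff_def by blast
  have T: "fps_nth (T r) s = poly (smult ((- 1) ^ s) p) (of_nat r)" if "r \<ge> 2" for r
    using that by (simp add: T_eq_walk_series p)
  have "u_poly s = smult ((- 1) ^ s) p"
    unfolding u_poly_def
  proof (rule the_equality)
    fix q :: "'a poly" assume "\<forall>r::nat. r \<ge> 2 \<longrightarrow> poly q (of_nat r) = fps_nth (T r) s"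
    then show "q = smult ((- 1) ^ s) p"
      using T by (intro poly_eqI_nat[of 2]) simp
  qed (use T in simp)
  then show ?thesis
    by (simp add: u_def p)
qed

lemma walk_series_nth_0 [simp]: "fps_nth (walk_series t) 0 = 1"
  by (simp add: walk_series_def)

lemma walk_series_nth_1: "fps_nth (walk_series t) (Suc 0) = - t"
proof -
  have "walk_series t * (1 + fps_const t * walk_root t) = 1"
    unfolding walk_series_def by (rule inverse_mult_eq_1) simp
  then have "fps_nth (walk_series t * (1 + fps_const t * walk_root t)) (Suc 0) = 0"
    by simp
  then show ?thesis
    by (simp add: fps_mult_nth walk_root_nth_Suc sqrt_quot_def add_eq_0_iff)
qed

section \<open>The recurrence for the coefficients\<close>

text \<open>The exponent \<open>P\<close> in the definition of \<open>M\<close> satisfies \<open>X P' = n (1 - T(- X))\<close>: the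
operation \<open>P \<mapsto> X P'\<close> clears the denominators \<open>s\<close>. The recurrence
is the coefficient form of \<open>X H' = X P' H\<close> for \<open>H = exp P\<close>.\<close>

lemma M_Suc:
  assumes "r \<ge> 1"
  shows "of_nat (Suc j) * M r n (Suc j) = of_nat n *
    (\<Sum>t\<le>j. fps_nth (1 - walk_series (of_nat r)) (Suc t) * M r n (j - t) :: 'a::field_char_0)"
proof -
  let ?V = "walk_series (of_nat r) :: 'a fps"
  define P :: "'a fps" where "P = fps_const (of_nat n * of_nat r) * fps_X -
      Abs_fps (\<lambda>s. if s \<ge> 2 then of_nat n * u s r / of_nat s * (-1) ^ s else 0)"
  define H where "H = fps_exp 1 oo P"
  have M_H: "M r n = fps_nth H"
    by (simp add: M_def P_def H_def fun_eq_iff)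
  have "fps_X * fps_deriv P = fps_const (of_nat n) * (1 - ?V)"
  proof (rule fps_ext)
    fix s :: nat
    consider "s = 0" | "s = 1" | "s \<ge> 2"
      by linarith
    then show "fps_nth (fps_X * fps_deriv P) s = fps_nth (fps_const (of_nat n) * (1 - ?V)) s"
    proof cases
      case 3
      then obtain s' where s': "s = Suc s'" "s' \<noteq> 0"
        by (cases s) auto
      have "fps_nth P s = - (of_nat n * fps_nth ?V s / of_nat s)"
        using 3 s' by (simp add: P_def u_eq[OF assms] del: of_nat_Suc flip: power_add)
      then show ?thesis
        using s' by (simp del: of_nat_Suc)
    qed (simp_all add: P_def walk_series_nth_1)
  qed
  moreover have "fps_deriv H = H * fps_deriv P"
    by (simp add: H_def P_def fps_compose_deriv)
  ultimately have "fps_X * fps_deriv H = fps_const (of_nat n) * ((1 - ?V) * H)"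
    by (metis mult.assoc mult.commute)
  then have "fps_nth (fps_X * fps_deriv H) (Suc j) = of_nat n *
      (\<Sum>i\<in>{0..Suc j}. fps_nth (1 - ?V) i * fps_nth H (Suc j - i))"
    by (simp only: fps_mult_left_const_nth fps_mult_nth[of "1 - ?V"])
  also have "fps_nth (fps_X * fps_deriv H) (Suc j) = of_nat (Suc j) * fps_nth H (Suc j)"
    by simp
  also have "(\<Sum>i\<in>{0..Suc j}. fps_nth (1 - ?V) i * fps_nth H (Suc j - i))
      = (\<Sum>t\<le>j. fps_nth (1 - ?V) (Suc t) * fps_nth H (j - t))"
    by (simp only: atLeast0AtMost sum.atMost_Suc_shift) simp
  finally show ?thesis
    by (simp only: M_H)
qed

text \<open>The weights of the recurrence after \<open>M\<close> has been divided by \<open>(n r) ^ j / j!\<close>.\<close>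

definition step_series :: "'a::field_char_0 \<Rightarrow> 'a fps" where
  "step_series t = Abs_fps (\<lambda>h. fps_nth (1 - walk_series t) (Suc h) / t ^ Suc h)"

text \<open>\<open>M r n j\<close> divided by \<open>(n r) ^ j / j!\<close>, as a polynomial in \<open>1/n\<close>. Reading the recurrence
as a definition avoids having to expand the exponential.\<close>

fun normalized_M_poly :: "nat \<Rightarrow> nat \<Rightarrow> 'a::field_char_0 poly" where
  "normalized_M_poly r 0 = 1"
| "normalized_M_poly r (Suc j) = (\<Sum>t\<le>j. monom
     (fps_nth (step_series (of_nat r)) t * (\<Prod>k<t. of_nat j - of_nat k)) t * normalized_M_poly r (j - t))"

lemma falling_mult_fact:
  "t \<le> j \<Longrightarrow> (\<Prod>k<t. of_nat j - of_nat k) * fact (j - t) = (fact j :: 'a::field_char_0)"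
proof (induction t)
  case (Suc t)
  then have "fact (j - t) = (of_nat j - of_nat t) * (fact (j - Suc t) :: 'a)"
    by (subst fact_reduce) (simp_all add: of_nat_diff)
  with Suc show ?case
    by (simp add: mult.assoc)
qed simp

lemma M_eq_normalized_M_poly:
  assumes "r \<ge> 1" "n > 0"
  shows "M r n j = of_nat n ^ j * of_nat r ^ j / fact j *
    poly (normalized_M_poly r j) (1 / of_nat n :: 'a::field_char_0)"
proof (induction j rule: less_induct)
  case (less j)
  show ?case
  proof (cases j)
    case 0
    then show ?thesis
      by (simp add: M_def)
  next
    case (Suc i)
    let ?n = "of_nat n :: 'a" and ?r = "of_nat r :: 'a"
    let ?V = "walk_series (of_nat r) :: 'a fps"
    have nz: "?n \<noteq> 0" "?r \<noteq> 0"
      using assms by auto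
    have "of_nat (Suc i) * M r n (Suc i) = ?n *
        (\<Sum>t\<le>i. fps_nth (1 - ?V) (Suc t) * M r n (i - t))"
      by (rule M_Suc[OF assms(1)])
    also have "\<dots> = ?n * (\<Sum>t\<le>i. ?n ^ i * ?r ^ Suc i / fact i *
        poly (monom (fps_nth (step_series ?r) t * (\<Prod>k<t. of_nat i - of_nat k)) t *
          normalized_M_poly r (i - t)) (1 / ?n))"
    proof (intro arg_cong[of _ _ "\<lambda>x. ?n * x"] sum.cong refl)
      fix t assume "t \<in> {..i}"
      then have t: "t \<le> i"
        by simp
      let ?p = "poly (normalized_M_poly r (i - t)) (1 / ?n)"
      have M: "M r n (i - t) = ?n ^ (i - t) * ?r ^ (i - t) / fact (i - t) * ?p"
        using less.IH[of "i - t"] Suc by simp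
      have V: "fps_nth (1 - ?V) (Suc t) = fps_nth (step_series ?r) t * ?r ^ Suc t"
        using nz by (simp add: step_series_def)
      have pow: "?n ^ (i - t) = ?n ^ i * (1 / ?n) ^ t" "?r ^ Suc i = ?r ^ Suc t * ?r ^ (i - t)"
        using nz t by (simp_all add: power_diff power_one_over flip: power_add)
      have fct: "1 / fact (i - t) = (\<Prod>k<t. of_nat i - of_nat k) / (fact i :: 'a)"
        using falling_mult_fact[OF t, where ?'a = 'a] by (simp add: field_simps)
      have "fps_nth (1 - ?V) (Suc t) * M r n (i - t) =
          fps_nth (step_series ?r) t * ?r ^ Suc t * (?n ^ (i - t) * ?r ^ (i - t) * (1 / fact (i - t)) * ?p)"
        by (simp only: M V) simp
      then show "fps_nth (1 - ?V) (Suc t) * M r n (i - t) = ?n ^ i * ?r ^ Suc i / fact i *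
        poly (monom (fps_nth (step_series ?r) t * (\<Prod>k<t. of_nat i - of_nat k)) t *
          normalized_M_poly r (i - t)) (1 / ?n)"
        unfolding fct pow by (simp add: poly_monom mult_ac)
    qed
    also have "\<dots> = ?n * (?n ^ i * ?r ^ Suc i / fact i * poly (normalized_M_poly r (Suc i)) (1 / ?n))"
      by (simp add: poly_sum sum_distrib_left)
    finally have "M r n (Suc i) = ?n * (?n ^ i * ?r ^ Suc i / fact i *
        poly (normalized_M_poly r (Suc i)) (1 / ?n)) / of_nat (Suc i)"
      by (simp add: field_simps del: of_nat_Suc normalized_M_poly.simps power_Suc)
    then show ?thesis
      unfolding Suc by (simp add: mult_ac del: of_nat_Suc normalized_M_poly.simps)
  qed
qed

lemma a_series_nat_eq:
  assumes "r \<ge> 1"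
  shows "a_series_nat r j = (normalized_M_poly r j :: 'a::field_char_0 poly)"
  unfolding a_series_nat_def
proof (rule the_equality)
  fix p :: "'a poly"
  assume p: "\<forall>n::nat. n > 0 \<longrightarrow>
    M r n j = of_nat n ^ j * of_nat r ^ j / fact j * poly p (1 / of_nat n)"
  show "p = normalized_M_poly r j"
  proof (rule poly_eqI_sequence[of "\<lambda>n. 1 / of_nat n" 1])
    fix n :: nat assume n: "n \<ge> 1"
    then have "of_nat n ^ j * of_nat r ^ j / fact j \<noteq> (0 :: 'a)"
      using assms by simp
    with p n M_eq_normalized_M_poly[OF assms, of n j]
    show "poly p (1 / of_nat n) = poly (normalized_M_poly r j) (1 / of_nat n)"
      by (metis less_eq_Suc_le One_nat_def mult_left_cancel)
  qed (simp add: inj_on_def)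
qed (use M_eq_normalized_M_poly[OF assms] in blast)

lemma step_series_nth_0: "t \<noteq> 0 \<Longrightarrow> fps_nth (step_series t) 0 = 1"
  by (simp add: step_series_def walk_series_nth_1)

lemma falling_eq_0: "j < t \<Longrightarrow> (\<Prod>k<t. of_nat j - of_nat k) = (0 :: 'a::field_char_0)"
  by (intro prod_zero) auto

lemma coeff_normalized_M_poly_Suc:
  "coeff (normalized_M_poly r (Suc j)) s = (\<Sum>t\<le>s. fps_nth (step_series (of_nat r)) t *
     (\<Prod>k<t. of_nat j - of_nat k) * coeff (normalized_M_poly r (j - t)) (s - t) :: 'a::field_char_0)"
proof -
  let ?g = "\<lambda>t. if t \<le> s then fps_nth (step_series (of_nat r)) t *
     (\<Prod>k<t. of_nat j - of_nat k) * coeff (normalized_M_poly r (j - t)) (s - t) else (0 :: 'a)"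
  have "coeff (normalized_M_poly r (Suc j)) s = (\<Sum>t\<le>j. ?g t)"
    by (auto simp: coeff_sum coeff_monom_mult intro!: sum.cong)
  also have "\<dots> = (\<Sum>t\<le>j + s. ?g t)"
    by (intro sum.mono_neutral_left) (auto simp: falling_eq_0)
  also have "\<dots> = (\<Sum>t\<le>s. ?g t)"
    by (intro sum.mono_neutral_right) auto
  finally show ?thesis
    by simp
qed

definition falling_poly :: "nat \<Rightarrow> 'a::field_char_0 poly" where
  "falling_poly t = (\<Prod>k<t. [:- of_nat k, 1:])"

lemma poly_falling_poly [simp]: "poly (falling_poly t) x = (\<Prod>k<t. x - of_nat k)"
  by (simp add: falling_poly_def poly_prod)

text \<open>The term \<open>t = 0\<close> of the recurrence is the coefficient at \<open>j\<close> itself, and the other terms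
involve only smaller \<open>s\<close>. Hence the difference in \<open>j\<close> is a polynomial by induction on \<open>s\<close>, and
it has a polynomial antidifference.\<close>

lemma normalized_M_poly_coeff_is_poly:
  assumes "r \<ge> 1"
  shows "\<exists>p. \<forall>j. poly p (of_nat j) = (coeff (normalized_M_poly r j) s :: 'a::field_char_0)"
proof (induction s rule: less_induct)
  case (less s)
  then obtain P :: "nat \<Rightarrow> 'a poly" where
    P: "\<And>i j. i < s \<Longrightarrow> poly (P i) (of_nat j) = coeff (normalized_M_poly r j) i"
    by metis
  let ?b = "step_series (of_nat r) :: 'a fps"
  define D where "D = (\<Sum>t\<in>{1..s}. smult (fps_nth ?b t)
    (falling_poly t * pcompose (P (s - t)) [:- of_nat t, 1:]))"
  have "has_top_coeff (degree D) (poly D) (lead_coeff D)"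
    unfolding has_top_coeff_def by blast
  then obtain \<psi> where top: "has_top_coeff (Suc (degree D)) \<psi> (lead_coeff D / of_nat (Suc (degree D)))"
    and \<psi>0: "\<psi> 0 = coeff (normalized_M_poly r 0) s" and \<psi>: "\<And>x. \<psi> (x + 1) - \<psi> x = poly D x"
    by (rule antidifference[where e = "coeff (normalized_M_poly r 0) s"]) blast
  from top obtain p where p: "\<And>x. \<psi> x = poly p x"
    unfolding has_top_coeff_def by blast
  have D: "coeff (normalized_M_poly r (Suc j)) s - coeff (normalized_M_poly r j) s = poly D (of_nat j)" for j
  proof -
    have "coeff (normalized_M_poly r (Suc j)) s - coeff (normalized_M_poly r j) s =
        (\<Sum>t\<in>{1..s}. fps_nth ?b t * (\<Prod>k<t. of_nat j - of_nat k) *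
          coeff (normalized_M_poly r (j - t)) (s - t))"
      unfolding coeff_normalized_M_poly_Suc atMost_atLeast0 using assms
      by (subst sum.atLeast_Suc_atMost) (simp_all add: step_series_nth_0)
    also have "\<dots> = poly D (of_nat j)"
      unfolding D_def poly_sum
    proof (intro sum.cong refl)
      fix t assume t: "t \<in> {1..s}"
      show "fps_nth ?b t * (\<Prod>k<t. of_nat j - of_nat k) * coeff (normalized_M_poly r (j - t)) (s - t) =
        poly (smult (fps_nth ?b t) (falling_poly t * pcompose (P (s - t)) [:- of_nat t, 1:])) (of_nat j)"
      proof (cases "t \<le> j")
        case True
        then show ?thesis
          using P[of "s - t" "j - t"] t by (simp add: poly_pcompose of_nat_diff)
      qed (simp add: falling_eq_0)
    qed
    finally show ?thesis .
  qed
  have "poly p (of_nat j) = coeff (normalized_M_poly r j) s" for j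
  proof (induction j)
    case 0
    show ?case
      using \<psi>0 by (simp add: p)
  next
    case (Suc j)
    have "poly p (of_nat (Suc j)) = poly p (of_nat j) + poly D (of_nat j)"
      using \<psi>[of "of_nat j"] by (simp add: p algebra_simps)
    with Suc show ?case
      by (simp flip: D del: normalized_M_poly.simps)
  qed
  then show ?case
    by blast
qed

lemma a_of_nat:
  assumes "r \<ge> 1"
  shows "a s r (of_nat j) = (coeff (normalized_M_poly r j) s :: 'a::field_char_0)"
proof -
  obtain p :: "'a poly" where p: "\<forall>j. poly p (of_nat j) = coeff (normalized_M_poly r j) s"
    using normalized_M_poly_coeff_is_poly[OF assms] by blast
  then have "a_poly s r = p"
    unfolding a_poly_def a_series_nat_eq[OF assms]
    by (intro the_equality) (auto intro: poly_eqI_nat[of 0])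
  with p show ?thesis
    by (simp add: a_def)
qed

text \<open>Both sides are polynomials in \<open>x\<close>, and for natural \<open>x\<close> this is the recurrence above: the terms
with \<open>t > x\<close> disappear because their falling factorial does.\<close>

lemma a_recurrence:
  assumes "r \<ge> 1"
  shows "a h r (x + 1) = (\<Sum>t\<le>h. fps_nth (step_series (of_nat r)) t *
    (\<Prod>k<t. x - of_nat k) * a (h - t) r (x - of_nat t) :: 'a::field_char_0)"
proof -
  let ?b = "step_series (of_nat r) :: 'a fps"
  define R where "R = (\<Sum>t\<le>h. smult (fps_nth ?b t)
    (falling_poly t * pcompose (a_poly (h - t) r) [:- of_nat t, 1:]))"
  have R: "poly R x = (\<Sum>t\<le>h. fps_nth ?b t * (\<Prod>k<t. x - of_nat k) *
      a (h - t) r (x - of_nat t))" for x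
    unfolding R_def poly_sum by (simp add: poly_pcompose a_def algebra_simps)
  have L: "poly (pcompose (a_poly h r) [:1, 1:]) x = a h r (x + 1)" for x :: 'a
    by (simp add: poly_pcompose a_def add.commute)
  have "pcompose (a_poly h r) [:1, 1:] = R"
  proof (rule poly_eqI_nat)
    fix j :: nat
    have "a h r (of_nat j + 1) = (coeff (normalized_M_poly r (Suc j)) h :: 'a)"
      using a_of_nat[OF assms, of h "Suc j", where ?'a = 'a] by (simp add: add.commute del: normalized_M_poly.simps)
    also have "\<dots> = poly R (of_nat j)"
      unfolding R coeff_normalized_M_poly_Suc
    proof (intro sum.cong refl)
      fix t assume "t \<in> {..h}"
      show "fps_nth ?b t * (\<Prod>k<t. of_nat j - of_nat k) * coeff (normalized_M_poly r (j - t)) (h - t) =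
        fps_nth ?b t * (\<Prod>k<t. of_nat j - of_nat k) * a (h - t) r (of_nat j - of_nat t)"
      proof (cases "t \<le> j")
        case True
        then show ?thesis
          using a_of_nat[OF assms, of "h - t" "j - t", where ?'a = 'a] by (simp add: of_nat_diff)
      qed (simp add: falling_eq_0)
    qed
    finally show "poly (pcompose (a_poly h r) [:1, 1:]) (of_nat j) = poly R (of_nat j)"
      by (simp add: L)
  qed
  then show ?thesis
    using L R by metis
qed

definition a_fps :: "nat \<Rightarrow> 'a::field_char_0 \<Rightarrow> 'a fps" where
  "a_fps r x = Abs_fps (\<lambda>s. a s r x)"

lemma a_fps_nth_0:
  assumes "r \<ge> 1"
  shows "fps_nth (a_fps r x) 0 = (1 :: 'a::field_char_0)"
proof -
  have "coeff (normalized_M_poly r j) 0 = (1 :: 'a)" for j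
  proof (induction j)
    case (Suc j)
    then show ?case
      using assms unfolding coeff_normalized_M_poly_Suc by (simp add: step_series_nth_0)
  qed simp
  then have "a_poly 0 r = (1 :: 'a poly)"
    using a_of_nat[OF assms, of 0, where ?'a = 'a] by (intro poly_eqI_nat[of 0]) (simp add: a_def)
  then show ?thesis
    by (simp add: a_fps_def a_def)
qed

lemma a_fps_0: "r \<ge> 1 \<Longrightarrow> a_fps r 0 = (1 :: 'a::field_char_0 fps)"
  using a_of_nat[of r _ 0, where ?'a = 'a] by (simp add: a_fps_def fps_eq_iff)

section \<open>The saddle point equation\<close>

text \<open>The saddle point equation is \<open>1 - T(- x) = p\<close>, where \<open>T(- x) = 1 / (1 + t y)\<close> and
\<open>x = y + (t - 1) y ^ 2\<close>. Thus \<open>y = p / (t (1 - p))\<close>, which gives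
\<open>x = p (1 - p / t) / (t (1 - p) ^ 2)\<close>, that is, \<open>t x = p / bethe t\<close>. The series \<open>p\<close> is \<open>X\<close>
here.\<close>

lemma walk_series_at_saddle:
  fixes t :: "'a::field_char_0"
  assumes "t \<noteq> 0"
  shows "walk_series t oo (fps_const (1 / t) * (fps_X * inverse (bethe t))) = 1 - fps_X"
proof -
  define C where "C = fps_const (1 / t)"
  define d where "d = 1 - C * fps_X"
  define i where "i = inverse (1 - fps_X :: 'a fps)"
  define w where "w = C * (fps_X * inverse (bethe t))"
  define y where "y = C * fps_X * i"
  define v where "v = walk_root t oo w"
  have C: "fps_const t * C = 1"
    using assms by (simp add: C_def)
  have i: "(1 - fps_X) * i = 1"
    unfolding i_def by (rule inverse_mult_eq_1') simp
  have "inverse (bethe t) = i\<^sup>2 * inverse (inverse d)"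
    by (simp add: bethe_def d_def C_def i_def fps_inverse_mult fps_inverse_power)
  also have "inverse (inverse d) = d"
    by (rule fps_inverse_idempotent) (simp add: d_def)
  finally have w: "w = C * (fps_X * (i\<^sup>2 * d))"
    by (simp add: w_def)
  have w0: "fps_nth w 0 = 0"
    by (simp add: w_def)
  have y_eq: "y + (fps_const t - 1) * y\<^sup>2 = w"
    using C i unfolding y_def w d_def by algebra
  have "(walk_root t + fps_const (t - 1) * (walk_root t)\<^sup>2) oo w = fps_X oo w"
    by (simp only: walk_root_eq)
  then have v_eq: "v + (fps_const t - 1) * v\<^sup>2 = w"
    using w0 by (simp add: v_def fps_compose_add_distrib fps_compose_mult_distrib
        fps_compose_sub_distrib fps_compose_power flip: fps_const_sub)
  \<comment> \<open>Both \<open>v\<close> and \<open>y\<close> are roots of the same quadratic without constant term.\<close>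
  have "(v - y) * (1 + (fps_const t - 1) * (v + y)) = 0"
  proof -
    have "(v - y) * (1 + k * (v + y)) = (v + k * v\<^sup>2) - (y + k * y\<^sup>2)" for k
      by (simp add: algebra_simps power2_eq_square)
    then show ?thesis
      by (simp add: v_eq y_eq)
  qed
  moreover have "fps_nth (1 + (fps_const t - 1) * (v + y)) 0 = 1"
    by (simp add: v_def y_def)
  then have "1 + (fps_const t - 1) * (v + y) \<noteq> 0"
    by (metis fps_zero_nth zero_neq_one)
  ultimately have "v = y"
    by simp
  then have "(1 + fps_const t * v) * (1 - fps_X) = 1"
    using C i unfolding y_def by algebra
  then have "inverse (1 + fps_const t * v) = 1 - fps_X"
    by (rule fps_inverse_unique)
  then have "walk_series t oo w = 1 - fps_X"
    using w0 by (simp add: walk_series_def v_def fps_inverse_compose fps_compose_add_distrib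
        fps_compose_mult_distrib)
  then show ?thesis
    by (simp add: w_def C_def)
qed

lemma bethe_saddle:
  fixes t :: "'a::field_char_0"
  assumes "t \<noteq> 0"
  shows "bethe t = step_series t oo (fps_X * inverse (bethe t))"
proof -
  let ?L = "fps_const (1 / t) * fps_X"
  define w where "w = fps_X * inverse (bethe t)"
  have w0: "fps_nth w 0 = 0"
    by (simp add: w_def)
  have "fps_X * step_series t = 1 - (walk_series t oo ?L)"
  proof (rule fps_ext)
    fix h show "fps_nth (fps_X * step_series t) h = fps_nth (1 - (walk_series t oo ?L)) h"
      unfolding fps_sub_nth fps_nth_compose_linear
      by (cases h) (simp_all add: step_series_def power_one_over)
  qed
  then have "(fps_X * step_series t) oo w = (1 - (walk_series t oo ?L)) oo w"
    by simp
  moreover have "walk_series t oo ?L oo w = walk_series t oo (?L oo w)"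
    using w0 by (intro fps_compose_assoc[symmetric]) simp_all
  ultimately have "w * (step_series t oo w) = 1 - (walk_series t oo (?L oo w))"
    using w0 by (simp only: fps_compose_mult_distrib[OF w0] fps_compose_sub_distrib
        fps_X_fps_compose_startby0[OF w0] fps_compose_1)
  also have "?L oo w = fps_const (1 / t) * w"
    using w0 by (simp add: fps_compose_mult_distrib)
  finally have "w * (step_series t oo w) = fps_X"
    unfolding w_def walk_series_at_saddle[OF assms] by simp
  moreover have "inverse (bethe t) * bethe t = 1"
    by (rule inverse_mult_eq_1) simp
  then have "w * bethe t = fps_X"
    by (simp add: w_def mult.assoc)
  moreover have "w \<noteq> 0"
    using calculation(2) by auto
  ultimately have "step_series t oo w = bethe t"
    by (metis mult_left_cancel)
  then show ?thesis
    by (simp add: w_def)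
qed

lemma filtered_a_fps_ratio:
  assumes "r \<ge> 1"
  shows "filtered N (\<lambda>x. a_fps r (x + 1) * inverse (a_fps r x)) (bethe (of_nat r :: 'a::field_char_0))"
proof (rule filtered_ratio)
  show "fps_nth (a_fps r (x + 1)) h = (\<Sum>t\<le>h. fps_nth (step_series (of_nat r)) t *
      (\<Prod>k<t. x - of_nat k) * fps_nth (a_fps r (x - of_nat t)) (h - t))" for x :: 'a and h
    by (simp add: a_fps_def a_recurrence[OF assms])
  show "bethe (of_nat r :: 'a) = step_series (of_nat r) oo (fps_X * inverse (bethe (of_nat r)))"
    using assms by (intro bethe_saddle) simp
qed (simp_all add: a_fps_nth_0[OF assms])

text \<open>The logarithm of \<open>A\<close> is the sum of the logarithms of the ratios. These have degree at most
\<open>h\<close> in order \<open>h\<close>, and summation raises the degree by one and divides the top coefficient by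
\<open>h + 1\<close>.\<close>

lemma ln_a_fps_nth:
  assumes "r \<ge> 1" 
  obtains \<psi> :: "'a::field_char_0 \<Rightarrow> 'a" where
    "has_top_coeff (Suc h) \<psi> ((1 / of_nat r ^ h - 2) / of_nat h / of_nat (Suc h))"
    "\<And>j. fps_nth (ln_fps (a_fps r (of_nat j))) h = \<psi> (of_nat j)"
proof -
  define \<rho> where "\<rho> x = a_fps r (x + 1) * inverse (a_fps r x)" for x :: 'a
  note A0 = a_fps_nth_0[OF assms]
  have "filtered (Suc h) \<rho> (bethe (of_nat r))"
    unfolding \<rho>_def[abs_def] by (rule filtered_a_fps_ratio[OF assms])
  from filtered_ln_fps[OF this]
  have "has_top_coeff h (\<lambda>x. fps_nth (ln_fps (\<rho> x)) h) ((1 / of_nat r ^ h - 2) / of_nat h)"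
    by (simp add: filtered_def ln_bethe_nth)
  then obtain \<psi> where
    top: "has_top_coeff (Suc h) \<psi> ((1 / of_nat r ^ h - 2) / of_nat h / of_nat (Suc h))"
    and \<psi>0: "\<psi> 0 = 0" and \<psi>: "\<And>x. \<psi> (x + 1) - \<psi> x = fps_nth (ln_fps (\<rho> x)) h"
    by (rule antidifference[where e = 0]) blast
  have "fps_nth (ln_fps (a_fps r (of_nat j))) h = \<psi> (of_nat j)" for j
  proof (induction j)
    case 0
    have "ln_fps (1 * 1) = ln_fps 1 + ln_fps (1 :: 'a fps)"
      by (rule ln_fps_mult) simp_all
    then show ?case
      using assms by (simp add: a_fps_0 \<psi>0)
  next
    case (Suc j)
    let ?x = "of_nat j :: 'a"
    have "inverse (a_fps r ?x) * a_fps r ?x = 1"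
      by (rule inverse_mult_eq_1) (simp add: A0)
    then have "a_fps r (?x + 1) = a_fps r ?x * \<rho> ?x"
      unfolding \<rho>_def by algebra
    moreover have "ln_fps (a_fps r ?x * \<rho> ?x) = ln_fps (a_fps r ?x) + ln_fps (\<rho> ?x)"
      by (rule ln_fps_mult) (simp_all add: A0 \<rho>_def)
    ultimately have "ln_fps (a_fps r (?x + 1)) = ln_fps (a_fps r ?x) + ln_fps (\<rho> ?x)"
      by simp
    then have "fps_nth (ln_fps (a_fps r (?x + 1))) h = \<psi> ?x + (\<psi> (?x + 1) - \<psi> ?x)"
      by (simp add: Suc \<psi>)
    then show ?case
      by (simp add: add.commute)
  qed
  with top that show ?thesis
    by blast
qed

section \<open>The perturbed series\<close>

theorem theoremB1:
  fixes r h :: nat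
    and I :: "'i set"
    and z :: "'i \<Rightarrow> nat"
    and c :: "'i \<Rightarrow> 'a::field_char_0"
  assumes "1 \<le> r" and "r \<le> 10"
    and "finite I"
    and "\<forall>i\<in>I. z i \<ge> 4"
    and "1 \<le> h" and "h \<le> 26"
  shows "\<exists>q :: 'a poly.
    (\<forall>j::nat. j \<le> 100 \<longrightarrow> fps_nth (ln_fps (F r I z c j)) h = poly q (of_nat j)) \<and>
    (\<forall>k \<ge> h + 2. coeff q k = 0) \<and>
    coeff q (h + 1) = 1 / ((of_nat h + 1) * of_nat h) * (1 / of_nat r ^ h - 2)"
proof -
  let ?A = "a_fps r :: 'a \<Rightarrow> 'a fps"
  note A0 = a_fps_nth_0[OF assms(1)]
  \<comment> \<open>After division by \<open>A\<close>, the perturbation is filtered, so its logarithm has degree only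
    \<open>h\<close> in order \<open>h\<close> and does not reach the coefficient at \<open>h + 1\<close>.\<close>
  define K where "K x = (\<Sum>i\<in>I. fps_const (c i / of_nat r ^ z i * (\<Prod>k<z i. x - of_nat k)) *
      fps_X ^ z i * (?A (x - of_nat (z i)) * inverse (?A x)))" for x
  have K0: "fps_nth (K x) 0 = 0" for x
    unfolding K_def fps_sum_nth
    by (rule sum.neutral) (use assms(4) in \<open>force simp: mult.assoc fps_X_power_mult_nth\<close>)
  define g where "g i = fps_const (c i / of_nat r ^ z i * 1) * fps_X ^ z i *
      inverse (bethe (of_nat r :: 'a)) ^ z i" for i
  have "filtered (Suc h) K (\<Sum>i\<in>I. g i)"
    unfolding K_def[abs_def] g_def
  proof (rule filtered_sum)
    fix i
    have "filtered (Suc h) (\<lambda>x. ?A (x - of_nat (z i)) * inverse (?A x))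
        (inverse (bethe (of_nat r)) ^ z i)"
      by (rule filtered_backshift[OF A0 filtered_a_fps_ratio[OF assms(1)]]) simp
    from filtered_X_power_mult[OF has_top_coeff_cmult[OF has_top_coeff_falling] this]
    show "filtered (Suc h) (\<lambda>x. fps_const (c i / of_nat r ^ z i * (\<Prod>k<z i. x - of_nat k)) *
        fps_X ^ z i * (?A (x - of_nat (z i)) * inverse (?A x)))
        (fps_const (c i / of_nat r ^ z i * 1) * fps_X ^ z i * inverse (bethe (of_nat r)) ^ z i)"
      by (rule filtered_mono) simp
  qed
  from filtered_ln_fps[OF filtered_add[OF filtered_const[of _ 1] this]]
  obtain q2 where q2: "degree q2 \<le> h" "\<And>x. fps_nth (ln_fps (1 + K x)) h = poly q2 x"
    unfolding filtered_def has_top_coeff_def by fastforce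
  obtain \<psi> :: "'a \<Rightarrow> 'a" where
    \<psi>: "has_top_coeff (Suc h) \<psi> ((1 / of_nat r ^ h - 2) / of_nat h / of_nat (Suc h))"
       "\<And>j. fps_nth (ln_fps (?A (of_nat j))) h = \<psi> (of_nat j)"
    using ln_a_fps_nth[OF assms(1)] by blast
  then obtain q1 where q1: "degree q1 \<le> Suc h"
    "coeff q1 (Suc h) = (1 / of_nat r ^ h - 2) / of_nat h / of_nat (Suc h)"
    "\<And>j. fps_nth (ln_fps (?A (of_nat j))) h = poly q1 (of_nat j)"
    unfolding has_top_coeff_def by auto
  have F: "F r I z c j = ?A (of_nat j) * (1 + K (of_nat j))" for j
  proof -
    let ?x = "of_nat j :: 'a"
    have inv: "?A ?x * inverse (?A ?x) = 1"
      by (rule inverse_mult_eq_1') (simp add: A0)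
    have cancel: "?A ?x * (C * (B * inverse (?A ?x))) = C * B" for B C
      using inv by algebra
    show ?thesis
      unfolding F_def K_def a_fps_def[symmetric] distrib_left sum_distrib_left mult_1_right
      by (simp only: cancel times_divide_eq_left)
  qed
  have "fps_nth (ln_fps (F r I z c j)) h = poly (q1 + q2) (of_nat j)" for j
    unfolding F using q1(3) q2(2) by (subst ln_fps_mult) (simp_all add: A0 K0)
  moreover have "coeff (q1 + q2) k = 0" if "k \<ge> h + 2" for k
    using that q1(1) q2(1) by (simp add: coeff_eq_0)
  moreover have "coeff (q1 + q2) (h + 1) = 1 / ((of_nat h + 1) * of_nat h) * (1 / of_nat r ^ h - 2)"
    using q1(2) q2(1) by (simp add: coeff_eq_0 mult.commute add.commute)
  ultimately show ?thesis
    by blast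
qed

end
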